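(* Let $\mathbb{F}$ be a subfield of $\mathbb{R}$, let $X$ be a real linear space, let $D\subseteq X$ be a nonempty $\mathbb{F}$-algebraically open convex set, and let $\alpha:D^*\to[0,\infty)$ be an even function, where $D^*=D-D$. Let $f:D\to\mathbb{R}$ be a strongly $(\alpha,\mathbb{F})$-convex function. Then, for every $x_0\in D$, the $\mathbb{F}$-subgradient $\partial_{\mathbb{F}}f(x_0)$ is a nonempty convex subset of $X'_{\mathbb{F}}$ which is closed with respect to pointwise convergence, and $$\partial_{\mathbb{F}}f(x_0)=\{\varphi\in X'_{\mathbb{F}}\mid f(x)\geq f(x_0)+\varphi(x-x_0)+\alpha(x-x_0)\ \text{ for all } x\in D\}.$$ Furthermore, the set-valued map $\partial_{\mathbb{F}}f:D\to2^{X'_{\mathbb{F}}}$ is $\mathbb{F}$-maximal monotone and $\alpha$-cyclically monotone.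
   Context: Notation: $D^*:=D-D=\{x-y: x,y\in D\}$. "Convex set" has its usual (real) meaning. A nonempty set $D\subseteq X$ is $\mathbb{F}$-algebraically open if for all $x_0\in D$ and $h\in X$ there exists $\varepsilon>0$ such that the segment $[x_0,x_0+th]$ is contained in $D$ for all $t\in[0,\varepsilon]\cap\mathbb{F}$. A function $f:D\to\mathbb{R}$ is strongly $(\alpha,\mathbb{F})$-convex if for all $x,y\in D$ and $t\in\mathbb{F}\cap[0,1]$, $$f(tx+(1-t)y)\leq tf(x)+(1-t)f(y)-t\,\alpha\big((1-t)(x-y)\big)-(1-t)\,\alpha\big(t(y-x)\big).$$ $X'_{\mathbb{F}}$ is the set of all $\mathbb{F}$-linear functions $\varphi:X\to\mathbb{R}$, i.e. those that are additive and satisfy $\varphi(\lambda x)=\lambda\varphi(x)$ for all $x\in X$, $\lambda\in\mathbb{F}$. The $\mathbb{F}$-subgradient of $f:D\to\mathbb{R}$ at $x_0\in D$ is $$\partial_{\mathbb{F}}f(x_0):=\{\varphi\in X'_{\mathbb{F}}\mid f(x)\geq f(x_0)+\varphi(x-x_0)\ \text{ for all } x\in D\}.$$ A set-valued map $\Phi:D\to2^{X'_{\mathbb{F}}}$ is $\alpha$-cyclically monotone if $$\sum_{j=0}^{n}\big(\varphi_j(x_{j+1}-x_j)+\alpha(x_{j+1}-x_j)\big)\leq0$$ for every $n\in\mathbb{N}$, all $x_0,\dots,x_{n+1}\in D$ with $x_{n+1}=x_0$, and all $\varphi_j\in\Phi(x_j)$ ($j=0,\dots,n$). $\Phi:D\to2^{X'_{\mathbb{F}}}$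 is monotone if $\varphi(y-x)+\psi(x-y)\leq0$ for all $x,y\in D$, $\varphi\in\Phi(x)$, $\psi\in\Phi(y)$. It is $\mathbb{F}$-maximal monotone if it is monotone and, for any monotone map $\Psi:D\to2^{X'_{\mathbb{F}}}$ with $\Phi(x)\subseteq\Psi(x)$ for all $x\in D$, one has $\Phi(x)=\Psi(x)$ for all $x\in D$. *)

theory Defs
  imports "HOL-Analysis.Analysis"
begin

definition real_subfield :: "real set \<Rightarrow> bool" where
  "real_subfield F \<longleftrightarrow>
     0 \<in> F \<and> 1 \<in> F \<and>
     (\<forall>a\<in>F. \<forall>b\<in>F. a + b \<in> F \<and> a * b \<in> F) \<and>
     (\<forall>a\<in>F. - a \<in> F \<and> inverse a \<in> F)"

definition difference_set :: "'a::real_vector set \<Rightarrow> 'a set" where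
  "difference_set D = {x - y | x y. x \<in> D \<and> y \<in> D}"

definition algebraically_open :: "real set \<Rightarrow> 'a::real_vector set \<Rightarrow> bool" where
  "algebraically_open F D \<longleftrightarrow>
     D \<noteq> {} \<and>
     (\<forall>x0\<in>D. \<forall>h. \<exists>\<epsilon>>0. \<forall>t\<in>{0..\<epsilon>} \<inter> F. closed_segment x0 (x0 + t *\<^sub>R h) \<subseteq> D)"

text \<open>
  Functions on \<open>D\<close> and on its difference set are represented by total functions; only
  their values on these sets are ever used. In particular, for convex \<open>D\<close> the arguments of
  \<open>\<alpha>\<close> below lie in the difference set, as \<open>(1 - t)(x - y) = x - (tx + (1 - t)y)\<close>.
\<close>

definition strongly_convex ::
    "('a::real_vector \<Rightarrow> real) \<Rightarrow> real set \<Rightarrow> 'a set \<Rightarrow> ('a \<Rightarrow> real) \<Rightarrow> bool" where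
  "strongly_convex \<alpha> F D f \<longleftrightarrow>
     (\<forall>x\<in>D. \<forall>y\<in>D. \<forall>t\<in>F \<inter> {0..1}.
        f (t *\<^sub>R x + (1 - t) *\<^sub>R y)
          \<le> t * f x + (1 - t) * f y
             - t * \<alpha> ((1 - t) *\<^sub>R (x - y)) - (1 - t) * \<alpha> (t *\<^sub>R (y - x)))"

definition linear_functionals :: "real set \<Rightarrow> ('a::real_vector \<Rightarrow> real) set" where
  "linear_functionals F =
     {\<phi>. (\<forall>x y. \<phi> (x + y) = \<phi> x + \<phi> y) \<and> (\<forall>c\<in>F. \<forall>x. \<phi> (c *\<^sub>R x) = c * \<phi> x)}"

definition subgradient ::
    "real set \<Rightarrow> 'a::real_vector set \<Rightarrow> ('a \<Rightarrow> real) \<Rightarrow> 'a \<Rightarrow> ('a \<Rightarrow> real) set" where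
  "subgradient F D f x0 =
     {\<phi> \<in> linear_functionals F. \<forall>x\<in>D. f x \<ge> f x0 + \<phi> (x - x0)}"

text \<open>
  The function space \<open>'a \<Rightarrow> real\<close> is not an instance of \<^class>\<open>real_vector\<close>, so
  \<^const>\<open>convex\<close> does not apply to sets of functionals.
\<close>

definition convex_functionals :: "('a \<Rightarrow> real) set \<Rightarrow> bool" where
  "convex_functionals S \<longleftrightarrow>
     (\<forall>\<phi>\<in>S. \<forall>\<psi>\<in>S. \<forall>t\<in>{0..1}. (\<lambda>x. t * \<phi> x + (1 - t) * \<psi> x) \<in> S)"

definition set_valued_map ::
    "real set \<Rightarrow> 'a::real_vector set \<Rightarrow> ('a \<Rightarrow> ('a \<Rightarrow> real) set) \<Rightarrow> bool" where
  "set_valued_map F D \<Phi> \<longleftrightarrow> (\<forall>x\<in>D. \<Phi> x \<subseteq> linear_functionals F)"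

definition cyclically_monotone ::
    "('a::real_vector \<Rightarrow> real) \<Rightarrow> 'a set \<Rightarrow> ('a \<Rightarrow> ('a \<Rightarrow> real) set) \<Rightarrow> bool" where
  "cyclically_monotone \<alpha> D \<Phi> \<longleftrightarrow>
     (\<forall>n::nat. \<forall>x \<phi>.
        (\<forall>j\<le>n + 1. x j \<in> D) \<longrightarrow> x (n + 1) = x 0 \<longrightarrow> (\<forall>j\<le>n. \<phi> j \<in> \<Phi> (x j)) \<longrightarrow>
        (\<Sum>j=0..n. \<phi> j (x (j + 1) - x j) + \<alpha> (x (j + 1) - x j)) \<le> 0)"

definition monotone_map ::
    "'a::real_vector set \<Rightarrow> ('a \<Rightarrow> ('a \<Rightarrow> real) set) \<Rightarrow> bool" where
  "monotone_map D \<Phi> \<longleftrightarrow>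
     (\<forall>x\<in>D. \<forall>y\<in>D. \<forall>\<phi>\<in>\<Phi> x. \<forall>\<psi>\<in>\<Phi> y. \<phi> (y - x) + \<psi> (x - y) \<le> 0)"

definition maximal_monotone ::
    "real set \<Rightarrow> 'a::real_vector set \<Rightarrow> ('a \<Rightarrow> ('a \<Rightarrow> real) set) \<Rightarrow> bool" where
  "maximal_monotone F D \<Phi> \<longleftrightarrow>
     set_valued_map F D \<Phi> \<and> monotone_map D \<Phi> \<and>
     (\<forall>\<Psi>. set_valued_map F D \<Psi> \<longrightarrow> monotone_map D \<Psi> \<longrightarrow> (\<forall>x\<in>D. \<Phi> x \<subseteq> \<Psi> x) \<longrightarrow>
        (\<forall>x\<in>D. \<Phi> x = \<Psi> x))"

text \<open>
  The library topology on \<open>'a \<Rightarrow> real\<close> is the product topology, that is, the topology of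
  pointwise convergence.
\<close>

abbreviation pointwise_topology :: "real set \<Rightarrow> ('a::real_vector \<Rightarrow> real) topology" where
  "pointwise_topology F \<equiv> top_of_set (linear_functionals F)"

end

theory Submission
  imports Defs
begin

text \<open>Regard \<open>X\<close> as a vector space over \<open>F\<close>. Since \<alpha> is
  nonnegative, \<open>f\<close> is convex with weights in \<open>F\<close>, so its directional
  derivative at \<open>x0\<close>, the infimum of difference quotients with positive steps in
  \<open>F\<close>, is \<open>F\<close>-sublinear; openness supplies steps in every direction and
  thereby finiteness. A Hahn-Banach theorem over \<open>F\<close>
  (\<open>subfield_Hahn_Banach\<close>: minimal sublinear functions are linear, and Zorn provides
  them) puts an \<open>F\<close>-linear functional below it, which is a subgradient
  (\<open>subgradient_nonempty\<close>).

  The term \<alpha> enters the subgradient inequality by comparing strong convexity on a slightly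
  lengthened segment with the subgradient bound at an interior point, then shrinking the lengthening
  (\<open>subgradient_strong_ineq\<close>). Summing the improved inequality around a cycle
  telescopes, which is cyclic monotonicity. Maximality follows by testing a functional of a larger
  monotone map at \<open>x0\<close> against subgradients at points tending to \<open>x0\<close>.
  Convexity and closedness hold because the defining conditions are affine inequalities in the
  values of the functional.\<close>

section \<open>Arithmetic and limits in a subfield of the reals\<close>

lemma real_subfield_closed:
  assumes "real_subfield F"
  shows "0 \<in> F" "1 \<in> F" "a \<in> F \<Longrightarrow> b \<in> F \<Longrightarrow> a + b \<in> F" "a \<in> F \<Longrightarrow> b \<in> F \<Longrightarrow> a * b \<in> F"
    "a \<in> F \<Longrightarrow> - a \<in> F" "a \<in> F \<Longrightarrow> inverse a \<in> F"
    "a \<in> F \<Longrightarrow> b \<in> F \<Longrightarrow> a - b \<in> F" "a \<in> F \<Longrightarrow> b \<in> F \<Longrightarrow> a / b \<in> F"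
proof -
  show cl: "0 \<in> F" "1 \<in> F" "\<And>a b. a \<in> F \<Longrightarrow> b \<in> F \<Longrightarrow> a + b \<in> F" "\<And>a b. a \<in> F \<Longrightarrow> b \<in> F \<Longrightarrow> a * b \<in> F"
    "\<And>a. a \<in> F \<Longrightarrow> - a \<in> F" "\<And>a. a \<in> F \<Longrightarrow> inverse a \<in> F"
    using assms by (auto simp: real_subfield_def)
  show "a - b \<in> F" if "a \<in> F" "b \<in> F"
    using cl(3)[OF that(1) cl(5)[OF that(2)]] by simp
  show "a / b \<in> F" if "a \<in> F" "b \<in> F"
    using cl(4)[OF that(1) cl(6)[OF that(2)]] by (simp add: divide_inverse)
qed

lemma real_subfield_small:
  assumes F: "real_subfield F" and "0 < e"
  obtains s where "s \<in> F" "0 < s" "s < e"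
proof -
  have "real n \<in> F" for n
    by (induction n) (auto intro: real_subfield_closed[OF F])
  moreover obtain n where "inverse (real (Suc n)) < e"
    using reals_Archimedean[OF \<open>0 < e\<close>] by blast
  ultimately show thesis
    by (intro that[of "inverse (real (Suc n))"] real_subfield_closed(6)[OF F]) (auto simp del: of_nat_Suc)
qed

text \<open>This is the limit \<open>s\<close> to 0 taken inside \<open>F\<close>; it ends both
  limiting arguments about subgradients.\<close>

lemma real_subfield_le_limit:
  assumes F: "real_subfield F"
    and le: "\<And>s. s \<in> F \<Longrightarrow> 0 < s \<Longrightarrow> s < 1 \<Longrightarrow> a \<le> b + s * c"
  shows "a \<le> b"
proof (rule ccontr)
  assume "\<not> a \<le> b"
  then have "0 < min 1 ((a - b) / (\<bar>c\<bar> + 1))" by simp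
  then obtain s where s: "s \<in> F" "0 < s" "s < min 1 ((a - b) / (\<bar>c\<bar> + 1))"
    using real_subfield_small[OF F] by metis
  then have "s * (\<bar>c\<bar> + 1) < a - b" by (simp add: pos_less_divide_eq)
  moreover have "s * c \<le> s * (\<bar>c\<bar> + 1)" using s by (intro mult_left_mono) auto
  moreover have "a \<le> b + s * c" using le s by simp
  ultimately show False by simp
qed

text \<open>The step lies in \<open>F\<close> so that it can serve as a convexity weight or a scalar
  of an \<open>F\<close>-linear functional.\<close>

lemma algebraically_open_step:
  assumes F: "real_subfield F" and D: "algebraically_open F D" and "x \<in> D"
  obtains \<delta> where "\<delta> \<in> F" "0 < \<delta>" "\<delta> < 1" "x + \<delta> *\<^sub>R h \<in> D"
proof -
  obtain e where e: "e > 0" "\<And>t. t \<in> {0..e} \<inter> F \<Longrightarrow> closed_segment x (x + t *\<^sub>R h) \<subseteq> D"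
    using D \<open>x \<in> D\<close> unfolding algebraically_open_def by meson
  from \<open>e > 0\<close> have "0 < min e 1" by simp
  then obtain s where "s \<in> F" "0 < s" "s < min e 1" using real_subfield_small[OF F] by blast
  moreover from this have "x + s *\<^sub>R h \<in> D" using e(2)[of s] by (auto simp: ends_in_segment subset_iff)
  ultimately show thesis using that by simp
qed

section \<open>Sublinear functions over a subfield\<close>

text \<open>Homogeneity is only an inequality, which infima satisfy readily; applying it to
  \<open>inverse c\<close> recovers equality.\<close>

definition subfield_sublinear :: "real set \<Rightarrow> ('a::real_vector \<Rightarrow> real) \<Rightarrow> bool" where
  "subfield_sublinear F p \<longleftrightarrow>
     (\<forall>x y. p (x + y) \<le> p x + p y) \<and> (\<forall>c\<in>F. 0 \<le> c \<longrightarrow> (\<forall>x. p (c *\<^sub>R x) \<le> c * p x))"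

lemma subfield_sublinearD:
  assumes "subfield_sublinear F p"
  shows "p (x + y) \<le> p x + p y" "c \<in> F \<Longrightarrow> 0 \<le> c \<Longrightarrow> p (c *\<^sub>R x) \<le> c * p x"
  using assms by (auto simp: subfield_sublinear_def)

lemma subfield_sublinear_zero:
  assumes "real_subfield F" "subfield_sublinear F p"
  shows "p 0 = 0"
  using subfield_sublinearD(1)[OF assms(2), of 0 0]
    subfield_sublinearD(2)[OF assms(2) real_subfield_closed(1)[OF assms(1)], of 0] by simp

lemma subfield_sublinear_scaleR:
  assumes F: "real_subfield F" and p: "subfield_sublinear F p" and c: "c \<in> F" "0 \<le> c"
  shows "p (c *\<^sub>R x) = c * p x"
proof (cases "c = 0")
  case True
  then show ?thesis using subfield_sublinear_zero[OF F p] by simp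
next
  case False
  then have "p x \<le> inverse c * p (c *\<^sub>R x)"
    using subfield_sublinearD(2)[OF p real_subfield_closed(6)[OF F c(1)], of "c *\<^sub>R x"] c by simp
  then have "c * p x \<le> p (c *\<^sub>R x)" using False c by (simp add: field_simps)
  then show ?thesis using subfield_sublinearD(2)[OF p c, of x] by simp
qed

text \<open>Common scheme for three infima: the minimality test, the lower bound of a chain and the
  directional derivative.\<close>

lemma Inf_subfield_sublinear:
  fixes S :: "'a::real_vector \<Rightarrow> real set"
  assumes ne: "\<And>x. S x \<noteq> {}"
    and zero: "\<And>a. a \<in> S 0 \<Longrightarrow> 0 \<le> a"
    and add: "\<And>x y a b. a \<in> S x \<Longrightarrow> b \<in> S y \<Longrightarrow> \<exists>d\<in>S (x + y). d \<le> a + b"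
    and scale: "\<And>c x a. c \<in> F \<Longrightarrow> 0 \<le> c \<Longrightarrow> a \<in> S x \<Longrightarrow> \<exists>d\<in>S (c *\<^sub>R x). d \<le> c * a"
  shows "subfield_sublinear F (\<lambda>x. Inf (S x))" and "\<And>x a. a \<in> S x \<Longrightarrow> Inf (S x) \<le> a"
proof -
  have bdd: "bdd_below (S x)" for x
  proof -
    \<comment> \<open>Any value at \<open>- x\<close> bounds \<open>S x\<close> below, since the sum
      of the two values dominates an element of \<open>S 0\<close>.\<close>
    obtain b where b: "b \<in> S (- x)" using ne by blast
    have "- b \<le> a" if "a \<in> S x" for a
      using add[OF that b] zero by force
    then show ?thesis by (rule bdd_belowI)
  qed
  show lower: "Inf (S x) \<le> a" if "a \<in> S x" for x a
    using that bdd by (rule cInf_lower)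
  have le: "Inf (S x) \<le> e" if "d \<in> S x" "d \<le> e" for x d e
    using lower[OF that(1)] that(2) by simp
  have "Inf (S (x + y)) \<le> Inf (S x) + Inf (S y)" for x y
  proof -
    have "Inf (S (x + y)) - a \<le> Inf (S y)" if a: "a \<in> S x" for a
    proof (rule cInf_greatest[OF ne])
      fix b assume "b \<in> S y"
      then show "Inf (S (x + y)) - a \<le> b" using add[OF a] le by force
    qed
    then have "Inf (S (x + y)) - Inf (S y) \<le> Inf (S x)"
      by (intro cInf_greatest[OF ne]) (simp add: algebra_simps)
    then show ?thesis by simp
  qed
  moreover have "Inf (S (c *\<^sub>R x)) \<le> c * Inf (S x)" if c: "c \<in> F" "0 \<le> c" for c x
  proof (cases "c = 0")
    case True
    obtain a where "a \<in> S x" using ne by blast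
    then show ?thesis using scale[OF c] le True by force
  next
    case False
    have "Inf (S (c *\<^sub>R x)) / c \<le> Inf (S x)"
    proof (rule cInf_greatest[OF ne])
      fix a assume "a \<in> S x"
      then have "Inf (S (c *\<^sub>R x)) \<le> c * a" using scale[OF c] le by blast
      then show "Inf (S (c *\<^sub>R x)) / c \<le> a" using False c by (simp add: field_simps)
    qed
    then show ?thesis using False c by (simp add: field_simps)
  qed
  ultimately show "subfield_sublinear F (\<lambda>x. Inf (S x))"
    by (simp add: subfield_sublinear_def)
qed

text \<open>
  For fixed \<open>y\<close>, minimality is tested against \<open>x \<mapsto> inf {p (x + ty) - t p y | t \<in> F, t \<ge> 0}\<close>: this is
  sublinear and at most \<open>p\<close>, so it equals \<open>p\<close>, and its value at \<open>x\<close> is at most \<open>p (x + y) - p y\<close>.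
\<close>

lemma minimal_subfield_sublinear_linear:
  assumes F: "real_subfield F" and p: "subfield_sublinear F p"
    and min: "\<And>q. subfield_sublinear F q \<Longrightarrow> q \<le> p \<Longrightarrow> q = p"
  shows "p \<in> linear_functionals F"
proof -
  note F_closed = real_subfield_closed[OF F]
  have ge: "p x + p y \<le> p (x + y)" for x y
  proof -
    define S where "S x = {p (x + t *\<^sub>R y) - t * p y | t. t \<in> F \<and> 0 \<le> t}" for x
    have SI: "p (z + t *\<^sub>R y) - t * p y \<in> S z" if "t \<in> F" "0 \<le> t" for z t
      using that by (auto simp: S_def)
    have 1: "S z \<noteq> {}" for z using SI[OF F_closed(1)] by blast
    have 2: "0 \<le> a" if "a \<in> S 0" for a
      using that subfield_sublinear_scaleR[OF F p] by (auto simp: S_def)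
    have 3: "\<exists>d\<in>S (u + v). d \<le> a + b" if ab: "a \<in> S u" "b \<in> S v" for u v a b
    proof -
      obtain s t where st: "s \<in> F" "0 \<le> s" "a = p (u + s *\<^sub>R y) - s * p y"
        "t \<in> F" "0 \<le> t" "b = p (v + t *\<^sub>R y) - t * p y" using ab by (auto simp: S_def)
      have "p ((u + v) + (s + t) *\<^sub>R y) - (s + t) * p y \<le> a + b"
        using subfield_sublinearD(1)[OF p, of "u + s *\<^sub>R y" "v + t *\<^sub>R y"] st
        by (simp add: algebra_simps)
      then show ?thesis using SI[of "s + t" "u + v"] st F_closed(3) by auto
    qed
    have 4: "\<exists>d\<in>S (c *\<^sub>R u). d \<le> c * a" if c: "c \<in> F" "0 \<le> c" "a \<in> S u" for u c a
    proof -
      obtain t where t: "t \<in> F" "0 \<le> t" "a = p (u + t *\<^sub>R y) - t * p y"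
        using c by (auto simp: S_def)
      have "p (c *\<^sub>R u + (c * t) *\<^sub>R y) - (c * t) * p y \<le> c * a"
        using subfield_sublinearD(2)[OF p c(1,2), of "u + t *\<^sub>R y"] unfolding t(3)
        by (simp add: algebra_simps)
      then show ?thesis using SI[of "c * t" "c *\<^sub>R u"] c t F_closed(4) by auto
    qed
    have q: "subfield_sublinear F (\<lambda>x. Inf (S x))" "\<And>x a. a \<in> S x \<Longrightarrow> Inf (S x) \<le> a"
      by (rule Inf_subfield_sublinear[of S F]; (assumption | rule 1 2 3 4)+)+
    have "(\<lambda>x. Inf (S x)) \<le> p"
      using q(2)[OF SI[OF F_closed(1)]] by (simp add: le_fun_def)
    then have "(\<lambda>x. Inf (S x)) = p" using min q(1) by blast
    then have "p x = Inf (S x)" by metis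
    also have "\<dots> \<le> p (x + 1 *\<^sub>R y) - 1 * p y" by (rule q(2)[OF SI]) (use F_closed in auto)
    finally show ?thesis by simp
  qed
  have add: "p (x + y) = p x + p y" for x y
    using ge[of x y] subfield_sublinearD(1)[OF p, of x y] by simp
  have minus: "p (- x) = - p x" for x
    using add[of x "- x"] subfield_sublinear_zero[OF F p] by simp
  have "p (c *\<^sub>R x) = c * p x" if "c \<in> F" for c x
    using subfield_sublinear_scaleR[OF F p, of c x] that minus[of "c *\<^sub>R x"]
      subfield_sublinear_scaleR[OF F p, of "- c" x] F_closed(5)
    by (cases "0 \<le> c") auto
  then show ?thesis using add by (simp add: linear_functionals_def)
qed

section \<open>Hahn-Banach over a subfield\<close>

lemma subfield_Hahn_Banach:
  fixes p :: "'a::real_vector \<Rightarrow> real"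
  assumes F: "real_subfield F" and p: "subfield_sublinear F p"
  obtains \<phi> where "\<phi> \<in> linear_functionals F" "\<phi> \<le> p"
proof -
  define A where "A = {q. subfield_sublinear F q \<and> q \<le> p}"
  \<comment> \<open>Zorn's lemma runs in the reversed order, so chains need lower bounds; the
    pointwise infimum is one.\<close>
  have "\<exists>m\<in>A. \<forall>q\<in>A. m \<ge> q \<longrightarrow> q = m"
  proof (rule predicate_Zorn)
    show "partial_order_on A (relation_of (\<ge>) A)"
      by (rule partial_order_on_relation_ofI) auto
  next
    show "\<exists>u\<in>A. \<forall>q\<in>C. q \<ge> u" if "C \<in> Chains (relation_of (\<ge>) A)" for C
    proof (cases "C = {}")
      case True
      then show ?thesis using p by (auto simp: A_def)
    next
      case False
      have CA: "subfield_sublinear F q" "q \<le> p" if "q \<in> C" for q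
        using Chains_relation_of[OF \<open>C \<in> _\<close>] that by (auto simp: A_def)
      have total: "q \<le> r \<or> r \<le> q" if "q \<in> C" "r \<in> C" for q r
        using \<open>C \<in> _\<close> that by (auto simp: Chains_def relation_of_def)
      define S where "S x = (\<lambda>q. q x) ` C" for x
      have 1: "S x \<noteq> {}" for x using False by (simp add: S_def)
      have 2: "0 \<le> a" if "a \<in> S 0" for a
        using that subfield_sublinear_zero[OF F CA(1)] by (force simp: S_def)
      have 3: "\<exists>d\<in>S (x + y). d \<le> a + b" if ab: "a \<in> S x" "b \<in> S y" for x y a b
      proof -
        obtain q r where qr: "q \<in> C" "r \<in> C" "a = q x" "b = r y" using ab by (auto simp: S_def)
        \<comment> \<open>The smaller of \<open>q\<close> and \<open>r\<close> bounds both terms at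
          once; here the chain property gives subadditivity of the infimum.\<close>
        then obtain m where m: "m \<in> C" "m \<le> q" "m \<le> r" using total by blast
        have "m (x + y) \<le> m x + m y" using subfield_sublinearD(1)[OF CA(1)[OF m(1)]] .
        also have "\<dots> \<le> a + b" using m qr by (simp add: le_fun_def add_mono)
        finally show ?thesis using m by (auto simp: S_def)
      qed
      have 4: "\<exists>d\<in>S (c *\<^sub>R x). d \<le> c * a" if "c \<in> F" "0 \<le> c" "a \<in> S x" for x c a
        using that subfield_sublinearD(2)[OF CA(1)] by (auto simp: S_def)
      have q: "subfield_sublinear F (\<lambda>x. Inf (S x))" "\<And>x a. a \<in> S x \<Longrightarrow> Inf (S x) \<le> a"
        by (rule Inf_subfield_sublinear[of S F]; (assumption | rule 1 2 3 4)+)+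
      have low: "(\<lambda>x. Inf (S x)) \<le> r" if "r \<in> C" for r
        using that by (intro le_funI q(2)) (auto simp: S_def)
      obtain r where "r \<in> C" using False by blast
      with low CA(2) have "(\<lambda>x. Inf (S x)) \<le> p" by (meson order_trans)
      then have "(\<lambda>x. Inf (S x)) \<in> A" using q(1) by (simp add: A_def)
      then show ?thesis using low by blast
    qed
  qed
  then obtain m where m: "m \<in> A" "\<And>q. q \<in> A \<Longrightarrow> q \<le> m \<Longrightarrow> q = m" by auto
  have "m \<in> linear_functionals F"
  proof (rule minimal_subfield_sublinear_linear[OF F])
    show "subfield_sublinear F m" using m(1) by (simp add: A_def)
    show "q = m" if "subfield_sublinear F q" "q \<le> m" for q
      using that m by (auto simp: A_def)
  qed
  then show thesis using that m(1) by (simp add: A_def)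
qed

section \<open>Subgradients\<close>

text \<open>The case \<alpha> = 0 of \<open>strongly_convex\<close>; existence of subgradients and
  maximality are proved at this level.\<close>

definition subfield_convex :: "real set \<Rightarrow> 'a::real_vector set \<Rightarrow> ('a \<Rightarrow> real) \<Rightarrow> bool" where
  "subfield_convex F D f \<longleftrightarrow>
     (\<forall>x\<in>D. \<forall>y\<in>D. \<forall>t\<in>F \<inter> {0..1}. f (t *\<^sub>R x + (1 - t) *\<^sub>R y) \<le> t * f x + (1 - t) * f y)"

lemma subfield_convexD:
  assumes "subfield_convex F D f" "x \<in> D" "y \<in> D" "t \<in> F" "0 \<le> t" "t \<le> 1"
  shows "f (t *\<^sub>R x + (1 - t) *\<^sub>R y) \<le> t * f x + (1 - t) * f y"
  using assms by (auto simp: subfield_convex_def)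

lemma convexD_one_minus:
  assumes "convex D" "x \<in> D" "y \<in> D" "0 \<le> t" "t \<le> 1"
  shows "t *\<^sub>R x + (1 - t) *\<^sub>R y \<in> D"
  using convexD[OF assms(1-3), of t "1 - t"] assms by simp

text \<open>With \<open>z\<close> the convex combination, the arguments of \<alpha> are
  \<open>x - z\<close> and \<open>y - z\<close>, hence differences of points of \<open>D\<close>,
  and the subtracted terms are nonnegative.\<close>

lemma strongly_convex_imp_subfield_convex:
  assumes D: "convex D" and \<alpha>: "\<forall>u\<in>difference_set D. \<alpha> u \<ge> 0"
    and f: "strongly_convex \<alpha> F D f"
  shows "subfield_convex F D f"
  unfolding subfield_convex_def
proof (intro ballI)
  fix x y t assume xy: "x \<in> D" "y \<in> D" and t: "t \<in> F \<inter> {0..1}"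
  let ?z = "t *\<^sub>R x + (1 - t) *\<^sub>R y"
  have "?z \<in> D" using convexD_one_minus[OF D xy] t by simp
  moreover have "(1 - t) *\<^sub>R (x - y) = x - ?z" "t *\<^sub>R (y - x) = y - ?z"
    by (simp_all add: algebra_simps)
  ultimately have "0 \<le> \<alpha> ((1 - t) *\<^sub>R (x - y))" "0 \<le> \<alpha> (t *\<^sub>R (y - x))"
    using \<alpha> xy by (auto simp: difference_set_def)
  then have "0 \<le> t * \<alpha> ((1 - t) *\<^sub>R (x - y))" "0 \<le> (1 - t) * \<alpha> (t *\<^sub>R (y - x))"
    using t by auto
  moreover have "f ?z \<le> t * f x + (1 - t) * f y
      - t * \<alpha> ((1 - t) *\<^sub>R (x - y)) - (1 - t) * \<alpha> (t *\<^sub>R (y - x))"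
    using f xy t by (simp add: strongly_convex_def)
  ultimately show "f ?z \<le> t * f x + (1 - t) * f y" by simp
qed

lemma linear_functionalsD:
  assumes "\<phi> \<in> linear_functionals F"
  shows "\<phi> (x + y) = \<phi> x + \<phi> y" "c \<in> F \<Longrightarrow> \<phi> (c *\<^sub>R x) = c * \<phi> x"
    "\<phi> (- x) = - \<phi> x" "\<phi> (x - y) = \<phi> x - \<phi> y"
proof -
  show add: "\<phi> (x + y) = \<phi> x + \<phi> y" for x y using assms by (simp add: linear_functionals_def)
  show "c \<in> F \<Longrightarrow> \<phi> (c *\<^sub>R x) = c * \<phi> x" using assms by (simp add: linear_functionals_def)
  show minus: "\<phi> (- x) = - \<phi> x" for x using add[of 0 0] add[of x "- x"] by simp
  show "\<phi> (x - y) = \<phi> x - \<phi> y" using add[of x "- y"] minus by simp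
qed

text \<open>
  The directional derivative, an infimum of difference quotients, is sublinear: for quotients
  with steps \<open>t\<close> along \<open>h\<close> and \<open>s\<close> along \<open>k\<close>, the step \<open>ts / (t + s)\<close> along \<open>h + k\<close> gives
  a quotient not exceeding their sum.
\<close>

lemma subgradient_nonempty:
  assumes F: "real_subfield F" and op: "algebraically_open F D" and D: "convex D"
    and f: "subfield_convex F D f" and x0: "x0 \<in> D"
  shows "subgradient F D f x0 \<noteq> {}"
proof -
  note F_closed = real_subfield_closed[OF F]
  define S where "S h = {(f (x0 + t *\<^sub>R h) - f x0) / t | t. t \<in> F \<and> 0 < t \<and> x0 + t *\<^sub>R h \<in> D}" for h
  have SI: "(f (x0 + t *\<^sub>R h) - f x0) / t \<in> S h" if "t \<in> F" "0 < t" "x0 + t *\<^sub>R h \<in> D" for t h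
    using that by (auto simp: S_def)
  have 1: "S h \<noteq> {}" for h
    using algebraically_open_step[OF F op x0, of h] SI by (metis empty_iff)
  have 2: "0 \<le> a" if "a \<in> S 0" for a
    using that by (auto simp: S_def)
  have 3: "\<exists>d\<in>S (h + k). d \<le> a + b" if ab: "a \<in> S h" "b \<in> S k" for h k a b
  proof -
    obtain t s where t: "t \<in> F" "0 < t" "x0 + t *\<^sub>R h \<in> D" "a = (f (x0 + t *\<^sub>R h) - f x0) / t"
      and s: "s \<in> F" "0 < s" "x0 + s *\<^sub>R k \<in> D" "b = (f (x0 + s *\<^sub>R k) - f x0) / s"
      using ab by (auto simp: S_def)
    \<comment> \<open>This weight makes \<open>t * c\<close> and \<open>s * (1 - c)\<close> equal,
      so the combination of the two points is a step along \<open>h + k\<close>.\<close>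
    define c where "c = s / (t + s)"
    define u where "u = t * c"
    have c: "c \<in> F" "0 < c" "c < 1" using t s F_closed by (auto simp: c_def)
    have u: "u = s * (1 - c)" "u \<in> F" "0 < u" using t s c F_closed by (auto simp: u_def c_def field_simps)
    have eq: "x0 + u *\<^sub>R (h + k) = c *\<^sub>R (x0 + t *\<^sub>R h) + (1 - c) *\<^sub>R (x0 + s *\<^sub>R k)"
    proof -
      have "x0 + u *\<^sub>R (h + k) = x0 + (t * c) *\<^sub>R h + (s * (1 - c)) *\<^sub>R k"
        using u(1) by (simp add: u_def[symmetric] scaleR_add_right)
      then show ?thesis by (simp add: algebra_simps)
    qed
    have ta: "f (x0 + t *\<^sub>R h) = f x0 + t * a" and sb: "f (x0 + s *\<^sub>R k) = f x0 + s * b"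
      using t s by simp_all
    have "f (x0 + u *\<^sub>R (h + k)) \<le> c * f (x0 + t *\<^sub>R h) + (1 - c) * f (x0 + s *\<^sub>R k)"
      unfolding eq using subfield_convexD[OF f t(3) s(3)] c by simp
    also have "\<dots> = f x0 + c * (t * a) + (1 - c) * (s * b)"
      unfolding ta sb by (simp add: algebra_simps)
    also have "\<dots> = f x0 + u * (a + b)"
    proof -
      have "c * (t * a) = u * a" by (simp add: u_def)
      moreover have "(1 - c) * (s * b) = u * b" unfolding u(1) by (simp only: mult_ac)
      ultimately show ?thesis by (simp only: distrib_left add.assoc)
    qed
    finally have "(f (x0 + u *\<^sub>R (h + k)) - f x0) / u \<le> a + b"
      using u(3) by (simp add: field_simps)
    moreover have "x0 + u *\<^sub>R (h + k) \<in> D"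
      unfolding eq using convexD_one_minus[OF D t(3) s(3)] c by simp
    ultimately show ?thesis using SI[of u "h + k"] u by blast
  qed
  have 4: "\<exists>d\<in>S (c *\<^sub>R h). d \<le> c * a" if c: "c \<in> F" "0 \<le> c" "a \<in> S h" for h c a
  proof (cases "c = 0")
    case True
    then show ?thesis using SI[of 1 0] F_closed x0 by auto
  next
    case False
    obtain t where t: "t \<in> F" "0 < t" "x0 + t *\<^sub>R h \<in> D" "a = (f (x0 + t *\<^sub>R h) - f x0) / t"
      using c by (auto simp: S_def)
    have tc: "t / c \<in> F" "0 < t / c" using False c t F_closed by auto
    have eq: "(t / c) *\<^sub>R c *\<^sub>R h = t *\<^sub>R h" using False by simp
    have "(f (x0 + t *\<^sub>R h) - f x0) / (t / c) \<in> S (c *\<^sub>R h)"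
      using SI[OF tc, of "c *\<^sub>R h", unfolded eq] t(3) by blast
    moreover have "(f (x0 + t *\<^sub>R h) - f x0) / (t / c) = c * a" using t(4) by simp
    ultimately show ?thesis by force
  qed
  have p: "subfield_sublinear F (\<lambda>x. Inf (S x))" "\<And>x a. a \<in> S x \<Longrightarrow> Inf (S x) \<le> a"
    by (rule Inf_subfield_sublinear[of S F]; (assumption | rule 1 2 3 4)+)+
  obtain \<phi> where \<phi>: "\<phi> \<in> linear_functionals F" "\<phi> \<le> (\<lambda>h. Inf (S h))"
    using subfield_Hahn_Banach[OF F p(1)] by blast
  have "f x0 + \<phi> (x - x0) \<le> f x" if "x \<in> D" for x
  proof -
    have "\<phi> (x - x0) \<le> Inf (S (x - x0))" using \<phi>(2) by (simp add: le_fun_def)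
    also have "\<dots> \<le> (f (x0 + 1 *\<^sub>R (x - x0)) - f x0) / 1"
      by (rule p(2)[OF SI]) (use F_closed that in auto)
    finally show ?thesis by simp
  qed
  then show ?thesis using \<phi>(1) by (auto simp: subgradient_def)
qed

lemma convex_functionals_subgradient: "convex_functionals (subgradient F D f x0)"
  unfolding convex_functionals_def
proof (intro ballI)
  fix \<phi> \<psi> t assume \<phi>: "\<phi> \<in> subgradient F D f x0" and \<psi>: "\<psi> \<in> subgradient F D f x0" and t: "t \<in> {0..1::real}"
  have "(\<lambda>x. t * \<phi> x + (1 - t) * \<psi> x) \<in> linear_functionals F"
    using \<phi> \<psi> by (auto simp: subgradient_def linear_functionals_def algebra_simps)
  moreover have "t * \<phi> (x - x0) + (1 - t) * \<psi> (x - x0) \<le> f x - f x0" if "x \<in> D" for x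
    using \<phi> \<psi> t that by (intro convex_bound_le) (auto simp: subgradient_def algebra_simps)
  ultimately show "(\<lambda>x. t * \<phi> x + (1 - t) * \<psi> x) \<in> subgradient F D f x0"
    by (auto simp: subgradient_def algebra_simps)
qed

text \<open>Evaluation at a point is continuous, so the set is an intersection of closed half-spaces
  with the linear functionals.\<close>

lemma closedin_subgradient: "closedin (pointwise_topology F) (subgradient F D f x0)"
proof -
  have "closed {\<phi>::'a \<Rightarrow> real. f x \<ge> f x0 + \<phi> (x - x0)}" for x
    by (intro closed_Collect_le continuous_intros continuous_on_product_coordinates)
  then have "closed (\<Inter>x\<in>D. {\<phi>. f x \<ge> f x0 + \<phi> (x - x0)})" by blast
  moreover have "subgradient F D f x0 = linear_functionals F \<inter> (\<Inter>x\<in>D. {\<phi>. f x \<ge> f x0 + \<phi> (x - x0)})"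
    by (auto simp: subgradient_def)
  ultimately show ?thesis using closedin_closed by blast
qed

text \<open>
  Translating the pair \<open>x0, x\<close> by \<open>\<epsilon>v\<close> with \<open>v = x - x0\<close> makes \<open>x0 + \<epsilon>v\<close> an intermediate point of
  \<open>x0\<close> and \<open>x + \<epsilon>v\<close>, while its difference to \<open>x + \<epsilon>v\<close> is exactly \<open>v\<close>; hence the value \<open>\<alpha> v\<close> itself
  appears and no continuity of \<open>\<alpha>\<close> is needed in the limit \<open>\<epsilon> \<rightarrow> 0\<close>.
\<close>

lemma subgradient_strong_ineq:
  assumes F: "real_subfield F" and op: "algebraically_open F D" and D: "convex D"
    and \<alpha>: "\<forall>u\<in>difference_set D. \<alpha> u \<ge> 0" and f: "strongly_convex \<alpha> F D f"
    and x0: "x0 \<in> D" and x: "x \<in> D" and \<phi>: "\<phi> \<in> subgradient F D f x0"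
  shows "f x0 + \<phi> (x - x0) + \<alpha> (x - x0) \<le> f x"
proof -
  note F_closed = real_subfield_closed[OF F]
  note fc = strongly_convex_imp_subfield_convex[OF D \<alpha> f]
  define v where "v = x - x0"
  have lin: "\<phi> \<in> linear_functionals F" and sub: "\<And>y. y \<in> D \<Longrightarrow> f x0 + \<phi> (y - x0) \<le> f y"
    using \<phi> by (auto simp: subgradient_def)
  \<comment> \<open>Fixing one point of \<open>D\<close> beyond \<open>x\<close> lets convexity
    bound \<open>f\<close> at all nearer points \<open>x + (s * \<delta>) v\<close>, with an error
    linear in \<open>s\<close>.\<close>
  obtain \<delta> where \<delta>: "\<delta> \<in> F" "0 < \<delta>" "\<delta> < 1" "x + \<delta> *\<^sub>R v \<in> D"
    using algebraically_open_step[OF F op x] by blast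
  have "f x0 + \<phi> v + \<alpha> v \<le> f x + s * (f (x + \<delta> *\<^sub>R v) - f x - \<delta> * \<phi> v)"
    if s: "s \<in> F" "0 < s" "s < 1" for s
  proof -
    define e where "e = s * \<delta>"
    \<comment> \<open>As \<open>y - x0 = (1 + e) v\<close>, this weight gives
      \<open>z = t y + (1 - t) x0\<close> and \<open>(1 - t)(y - x0) = v\<close>.\<close>
    define t where "t = e / (1 + e)"
    define y where "y = x + e *\<^sub>R v"
    define z where "z = x0 + e *\<^sub>R v"
    have e: "e \<in> F" "0 < e" using s \<delta> F_closed by (auto simp: e_def)
    have t: "t \<in> F" "0 < t" "t < 1" using e F_closed by (auto simp: t_def)
    have te: "t * (1 + e) = e" using e by (simp add: t_def)
    have y_eq: "y = s *\<^sub>R (x + \<delta> *\<^sub>R v) + (1 - s) *\<^sub>R x"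
      by (simp add: y_def e_def algebra_simps)
    have y: "y \<in> D" "f y \<le> s * f (x + \<delta> *\<^sub>R v) + (1 - s) * f x"
      unfolding y_eq using convexD_one_minus[OF D \<delta>(4) x] subfield_convexD[OF fc \<delta>(4) x] s by auto
    have yx0: "y - x0 = (1 + e) *\<^sub>R v" by (simp add: y_def v_def algebra_simps)
    have z_eq: "t *\<^sub>R y + (1 - t) *\<^sub>R x0 = z"
    proof -
      have "t *\<^sub>R y + (1 - t) *\<^sub>R x0 = x0 + t *\<^sub>R (y - x0)" by (simp add: algebra_simps)
      then show ?thesis by (simp add: yx0 te z_def)
    qed
    have z: "z \<in> D" using convexD_one_minus[OF D y(1) x0, of t] t by (simp add: z_eq)
    have a1: "(1 - t) *\<^sub>R (y - x0) = v"
    proof -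
      have "(1 - t) * (1 + e) = 1" using te by (simp add: algebra_simps)
      then show ?thesis by (simp add: yx0)
    qed
    have "t *\<^sub>R (x0 - y) = x0 - z" by (simp add: z_eq[symmetric] algebra_simps)
    then have "0 \<le> \<alpha> (t *\<^sub>R (x0 - y))" using \<alpha> x0 z by (auto simp: difference_set_def)
    then have "0 \<le> (1 - t) * \<alpha> (t *\<^sub>R (x0 - y))" using t by simp
    moreover have "f z \<le> t * f y + (1 - t) * f x0 - t * \<alpha> v - (1 - t) * \<alpha> (t *\<^sub>R (x0 - y))"
      using f[unfolded strongly_convex_def, rule_format, OF y(1) x0, of t] t by (simp add: a1 z_eq)
    ultimately have "f z \<le> t * f y + (1 - t) * f x0 - t * \<alpha> v" by simp
    then have "(1 + e) * f z \<le> (1 + e) * (t * f y + (1 - t) * f x0 - t * \<alpha> v)"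
      using e by (intro mult_left_mono) auto
    also have "\<dots> = (t * (1 + e)) * f y + (1 + e - t * (1 + e)) * f x0 - (t * (1 + e)) * \<alpha> v"
      by (simp add: algebra_simps)
    also have "\<dots> = e * f y + f x0 - e * \<alpha> v" by (simp add: te)
    finally have up: "(1 + e) * f z \<le> e * f y + f x0 - e * \<alpha> v" .
    have low: "f x0 + e * \<phi> v \<le> f z"
      using sub[OF z] linear_functionalsD(2)[OF lin e(1), of v] by (simp add: z_def)
    \<comment> \<open>The bound \<open>low\<close> cancels \<open>f x0\<close> and leaves a common
      factor \<open>e\<close>; after division it is used again to replace
      \<open>f z\<close>.\<close>
    have "e * (\<phi> v + \<alpha> v + f z) \<le> e * f y" using up low by (simp add: algebra_simps)
    then have "\<phi> v + \<alpha> v + f z \<le> f y" using e by simp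
    then have "\<phi> v + \<alpha> v + (f x0 + e * \<phi> v) \<le> s * f (x + \<delta> *\<^sub>R v) + (1 - s) * f x"
      using low y(2) by linarith
    then show ?thesis by (simp add: e_def algebra_simps)
  qed
  from real_subfield_le_limit[OF F this] show ?thesis by (simp add: v_def)
qed

section \<open>Monotonicity properties of the subgradient map\<close>

lemma monotone_map_subgradient: "monotone_map D (subgradient F D f)"
  unfolding monotone_map_def subgradient_def by fastforce

text \<open>
  Monotonicity of \<open>\<psi>\<close> against a subgradient at \<open>x0 + t(x - x0)\<close> bounds
  \<open>(1 - t) \<psi>(x - x0)\<close> by \<open>f x - f (x0 + t(x - x0))\<close>, and a subgradient \<open>\<eta>\<close> at \<open>x0\<close> controls
  the limit \<open>t \<rightarrow> 0\<close>.
\<close>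

lemma maximal_monotone_subgradient:
  assumes F: "real_subfield F" and op: "algebraically_open F D" and D: "convex D"
    and f: "subfield_convex F D f"
  shows "maximal_monotone F D (subgradient F D f)"
  unfolding maximal_monotone_def
proof (intro conjI allI impI ballI)
  show "set_valued_map F D (subgradient F D f)"
    by (auto simp: set_valued_map_def subgradient_def)
  show "monotone_map D (subgradient F D f)" by (rule monotone_map_subgradient)
  fix \<Psi> x0
  assume sv: "set_valued_map F D \<Psi>" and mono: "monotone_map D \<Psi>"
    and ext: "\<forall>x\<in>D. subgradient F D f x \<subseteq> \<Psi> x" and x0: "x0 \<in> D"
  have "\<psi> \<in> subgradient F D f x0" if \<psi>: "\<psi> \<in> \<Psi> x0" for \<psi>
  proof -
    have lin: "\<psi> \<in> linear_functionals F" using sv \<psi> x0 by (auto simp: set_valued_map_def)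
    obtain \<eta> where \<eta>: "\<eta> \<in> subgradient F D f x0"
      using subgradient_nonempty[OF F op D f x0] by blast
    have "\<psi> (x - x0) \<le> f x - f x0" if x: "x \<in> D" for x
    proof (rule real_subfield_le_limit[OF F])
      fix t assume t: "t \<in> F" "0 < t" "t < 1"
      define v where "v = x - x0"
      define y where "y = x0 + t *\<^sub>R v"
      have "y = t *\<^sub>R x + (1 - t) *\<^sub>R x0" by (simp add: y_def v_def algebra_simps)
      then have y: "y \<in> D" using convexD_one_minus[OF D x x0] t by simp
      obtain \<phi> where \<phi>: "\<phi> \<in> subgradient F D f y"
        using subgradient_nonempty[OF F op D f y] by blast
      then have \<phi>_lin: "\<phi> \<in> linear_functionals F" and \<eta>_lin: "\<eta> \<in> linear_functionals F"
        using \<eta> by (auto simp: subgradient_def)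
      have yx0: "y - x0 = t *\<^sub>R v" "x0 - y = - (t *\<^sub>R v)" and xy: "x - y = v - t *\<^sub>R v"
        by (auto simp: y_def v_def algebra_simps)
      have "\<psi> (y - x0) + \<phi> (x0 - y) \<le> 0"
        using mono ext x0 y \<psi> \<phi> unfolding monotone_map_def by blast
      then have "t * \<psi> v \<le> t * \<phi> v"
        using t linear_functionalsD[OF lin] linear_functionalsD[OF \<phi>_lin] by (simp add: yx0)
      then have "(1 - t) * \<psi> v \<le> (1 - t) * \<phi> v" using t by simp
      moreover have "f y + \<phi> (x - y) \<le> f x" using \<phi> x by (simp add: subgradient_def)
      then have "f y + (1 - t) * \<phi> v \<le> f x"
        using t linear_functionalsD[OF \<phi>_lin] by (simp add: xy algebra_simps)
      \<comment> \<open>This lower bound on \<open>f y\<close> stands in for continuity of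
        \<open>f\<close> along the segment.\<close>
      moreover have "f x0 + \<eta> (y - x0) \<le> f y" using \<eta> y by (simp add: subgradient_def)
      then have "f x0 + t * \<eta> v \<le> f y" using t linear_functionalsD[OF \<eta>_lin] by (simp add: yx0)
      ultimately have "\<psi> v \<le> f x - f x0 + t * (\<psi> v - \<eta> v)" by (simp add: algebra_simps)
      then show "\<psi> (x - x0) \<le> f x - f x0 + t * (\<psi> (x - x0) - \<eta> (x - x0))" by (simp add: v_def)
    qed
    then show ?thesis using lin by (force simp: subgradient_def)
  qed
  then show "subgradient F D f x0 = \<Psi> x0" using ext x0 by blast
qed

text \<open>Each term is at most an increment of the potential \<open>f\<close>, and the increments
  around a closed cycle sum to zero.\<close>

lemma cyclically_monotone_potential:
  assumes "\<And>x y \<phi>. x \<in> D \<Longrightarrow> y \<in> D \<Longrightarrow> \<phi> \<in> \<Phi> x \<Longrightarrow> f x + \<phi> (y - x) + \<alpha> (y - x) \<le> f y"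
  shows "cyclically_monotone \<alpha> D \<Phi>"
  unfolding cyclically_monotone_def
proof (intro allI impI)
  fix n :: nat and x \<phi>
  assume x: "\<forall>j\<le>n + 1. x j \<in> D" and closed: "x (n + 1) = x 0" and \<phi>: "\<forall>j\<le>n. \<phi> j \<in> \<Phi> (x j)"
  have "(\<Sum>j=0..n. \<phi> j (x (j + 1) - x j) + \<alpha> (x (j + 1) - x j)) \<le> (\<Sum>j=0..n. f (x (Suc j)) - f (x j))"
  proof (rule sum_mono)
    fix j assume "j \<in> {0..n}"
    then show "\<phi> j (x (j + 1) - x j) + \<alpha> (x (j + 1) - x j) \<le> f (x (Suc j)) - f (x j)"
      using assms[of "x j" "x (j + 1)" "\<phi> j"] x \<phi> by auto
  qed
  also have "\<dots> = f (x (Suc n)) - f (x 0)" by (rule sum_Suc_diff) simp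
  also have "\<dots> = 0" using closed by simp
  finally show "(\<Sum>j=0..n. \<phi> j (x (j + 1) - x j) + \<alpha> (x (j + 1) - x j)) \<le> 0" .
qed

theorem theorem12:
  fixes F :: "real set" and D :: "'a::real_vector set" and \<alpha> f :: "'a \<Rightarrow> real"
  assumes "real_subfield F"
    and "D \<noteq> {}" and "algebraically_open F D" and "convex D"
    and "\<forall>u\<in>difference_set D. \<alpha> u \<ge> 0"
    and "\<forall>u\<in>difference_set D. \<alpha> (- u) = \<alpha> u"
    and "strongly_convex \<alpha> F D f"
  shows "(\<forall>x0\<in>D.
            subgradient F D f x0 \<noteq> {} \<and>
            subgradient F D f x0 \<subseteq> linear_functionals F \<and>
            convex_functionals (subgradient F D f x0) \<and>
            closedin (pointwise_topology F) (subgradient F D f x0) \<and>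
            subgradient F D f x0 =
              {\<phi> \<in> linear_functionals F. \<forall>x\<in>D. f x \<ge> f x0 + \<phi> (x - x0) + \<alpha> (x - x0)}) \<and>
         maximal_monotone F D (subgradient F D f) \<and>
         cyclically_monotone \<alpha> D (subgradient F D f)"
proof (intro conjI ballI)
  note fc = strongly_convex_imp_subfield_convex[OF assms(4,5,7)]
  note strong = subgradient_strong_ineq[OF assms(1,3,4,5,7)]
  fix x0 assume x0: "x0 \<in> D"
  show "subgradient F D f x0 \<noteq> {}"
    by (rule subgradient_nonempty[OF assms(1,3,4) fc x0])
  show "subgradient F D f x0 \<subseteq> linear_functionals F" by (auto simp: subgradient_def)
  show "convex_functionals (subgradient F D f x0)" by (rule convex_functionals_subgradient)
  show "closedin (pointwise_topology F) (subgradient F D f x0)" by (rule closedin_subgradient)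
  show "subgradient F D f x0 =
      {\<phi> \<in> linear_functionals F. \<forall>x\<in>D. f x \<ge> f x0 + \<phi> (x - x0) + \<alpha> (x - x0)}" (is "_ = ?R")
  proof
    show "subgradient F D f x0 \<subseteq> ?R"
      using strong[OF x0] by (auto simp: subgradient_def)
    have "0 \<le> \<alpha> (x - x0)" if "x \<in> D" for x
      using assms(5) x0 that by (auto simp: difference_set_def)
    then show "?R \<subseteq> subgradient F D f x0"
      by (fastforce simp: subgradient_def)
  qed
next
  show "maximal_monotone F D (subgradient F D f)"
    by (rule maximal_monotone_subgradient[OF assms(1,3,4)
          strongly_convex_imp_subfield_convex[OF assms(4,5,7)]])
  show "cyclically_monotone \<alpha> D (subgradient F D f)"
    by (rule cyclically_monotone_potential[of D _ f])
      (rule subgradient_strong_ineq[OF assms(1,3,4,5,7)])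
qed

end
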